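(* Let $1 \le p \le \infty$. For all sufficiently large integers $n$ (with threshold independent of $f$) and all $f \in L^1([0,1])$, $$\frac{1}{6}\,\omega_{1,p}\left(f, \frac{1}{n^3+n^2}\right) \le \|K_n f - f\|_\infty,$$ where $K_n$ is the Kantorovich operator and both sides are allowed to take the value $+\infty$.
   Context: The Kantorovich operator $K_n : L^1([0,1]) \to C([0,1])$ is $$K_n f(x) = (n+1)\sum_{k=0}^n \binom{n}{k} x^k (1-x)^{n-k} \int_{k/(n+1)}^{(k+1)/(n+1)} f(t)\,dt, \qquad x \in [0,1].$$ The first modulus of smoothness is $\omega_{1,p}(f,t) := \sup_{0<|h|\le t} \|\chi_{\{x \in [0,1] : x+h \in [0,1]\}}(x)\,(f(x+h)-f(x))\|_p$, where $\|\cdot\|_p$ is the $L^p([0,1])$ norm (essential supremum for $p=\infty$). *)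

theory Defs
  imports "HOL-Probability.Essential_Supremum"
begin

definition kantorovich :: "nat \<Rightarrow> (real \<Rightarrow> real) \<Rightarrow> real \<Rightarrow> real" where
  "kantorovich n f x =
     (real n + 1) * (\<Sum>k\<le>n. Bernstein n k x *
        (LINT t:{real k / (real n + 1)..(real k + 1) / (real n + 1)}|lebesgue. f t))"

text \<open>The norm is extended-valued, with value \<open>\<infinity>\<close> for measurable functions outside \<open>L\<^sup>p\<close>.
  The test for an infinite integral is needed because \<open>enn2real\<close> sends \<open>\<infinity>\<close> to \<open>0\<close>.\<close>

definition Lp_norm :: "ennreal \<Rightarrow> (real \<Rightarrow> real) \<Rightarrow> ennreal" where
  "Lp_norm p g =
     (if p = \<infinity> then esssup (lebesgue_on {0..1}) (\<lambda>x. ennreal \<bar>g x\<bar>)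
      else let I = (\<integral>\<^sup>+ x. ennreal (\<bar>g x\<bar> powr enn2real p) \<partial>lebesgue_on {0..1})
           in if I = \<infinity> then \<infinity> else ennreal (enn2real I powr (1 / enn2real p)))"

definition modulus1 :: "ennreal \<Rightarrow> (real \<Rightarrow> real) \<Rightarrow> real \<Rightarrow> ennreal" where
  "modulus1 p f t =
     (SUP h\<in>{h. 0 < \<bar>h\<bar> \<and> \<bar>h\<bar> \<le> t}.
        Lp_norm p (\<lambda>x. indicat_real {x \<in> {0..1}. x + h \<in> {0..1}} x * (f (x + h) - f x)))"

end

theory Submission
  imports Defs
begin

text \<open>Let \<open>e\<close> be the sup-norm of \<open>K\<^sub>n f - f\<close> and \<open>D\<close> the largest difference of the means of \<open>f\<close> over
  two adjacent cells of length \<open>1/(n+1)\<close>. The polynomial \<open>K\<^sub>n f\<close> is \<open>nD\<close>-Lipschitz on \<open>[0,1]\<close>, so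
  \<open>\<bar>f(x+h) - f(x)\<bar> \<le> 2e + nD\<bar>h\<bar>\<close> almost everywhere. Averaging this for \<open>h = 1/(n+1)\<close> over a cell
  gives \<open>D \<le> 2e + nD/(n+1)\<close>, that is \<open>D \<le> 2(n+1)e\<close>. For \<open>\<bar>h\<bar> \<le> 1/(n\<^sup>3+n\<^sup>2)\<close> the first bound then
  becomes \<open>(2 + 2/n)e \<le> 4e\<close>, and the \<open>L\<^sup>p\<close> norm on \<open>[0,1]\<close> is at most the sup-norm.\<close>

section \<open>Bernstein sums\<close>

lemma Bernstein_gt: "n < k \<Longrightarrow> Bernstein n k x = 0"
  by (simp add: Bernstein_def)

lemma Bernstein_Suc_0: "Bernstein (Suc n) 0 x = (1 - x) * Bernstein n 0 x"
  by (simp add: Bernstein_def)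

text \<open>Pascal's rule for the basis polynomials. The case split is due to truncated subtraction:
  the exponent \<open>n - k\<close> drops by one only for \<open>k < n\<close>; for
  \<open>k >= n\<close> the first summand vanishes.\<close>

lemma Bernstein_Suc_Suc:
  "Bernstein (Suc n) (Suc k) x = (1 - x) * Bernstein n (Suc k) x + x * Bernstein n k x"
proof (cases "k < n")
  case True
  then have eq: "(1 - x) ^ (n - k) = (1 - x) * (1 - x) ^ (n - Suc k)"
    by (metis Suc_diff_Suc power_Suc)
  then show ?thesis
    unfolding Bernstein_def diff_Suc_Suc binomial_Suc_Suc eq by (simp add: algebra_simps)
qed (auto simp: Bernstein_def not_less le_less binomial_eq_0)

text \<open>One de Casteljau step: degree \<open>Suc n\<close> is a blend, with weights
  \<open>1 - x\<close> and \<open>x\<close>, of two degree \<open>n\<close> polynomials whose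
  coefficients are \<open>c\<close> and its shift.\<close>

lemma sum_Bernstein_Suc:
  "(\<Sum>k\<le>Suc n. Bernstein (Suc n) k x * c k) =
     (1 - x) * (\<Sum>k\<le>n. Bernstein n k x * c k) + x * (\<Sum>k\<le>n. Bernstein n k x * c (Suc k))"
proof -
  \<comment> \<open>Appending the zero term \<open>k = Suc n\<close> allows the leading term to be
    split off with the upper limit still \<open>n\<close>.\<close>
  have "(\<Sum>k\<le>n. Bernstein n k x * c k) =
      Bernstein n 0 x * c 0 + (\<Sum>k\<le>n. Bernstein n (Suc k) x * c (Suc k))"
    using sum.atMost_Suc_shift[of "\<lambda>k. Bernstein n k x * c k" n] by (simp add: Bernstein_gt)
  then show ?thesis
    unfolding sum.atMost_Suc_shift
    by (simp add: Bernstein_Suc_0 Bernstein_Suc_Suc sum.distrib sum_subtractf sum_distrib_left algebra_simps)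
qed

lemma abs_sum_Bernstein_le:
  assumes "x \<in> {0..1}" "\<And>k. k \<le> n \<Longrightarrow> \<bar>c k\<bar> \<le> D"
  shows "\<bar>\<Sum>k\<le>n. Bernstein n k x * c k\<bar> \<le> D"
proof -
  have "\<bar>\<Sum>k\<le>n. Bernstein n k x * c k\<bar> \<le> (\<Sum>k\<le>n. Bernstein n k x * D)"
    using assms Bernstein_nonneg[of x n]
    by (intro order_trans[OF sum_abs] sum_mono) (auto simp: abs_mult intro!: mult_mono)
  then show ?thesis
    by (simp add: sum_distrib_right[symmetric])
qed

text \<open>Induction along the de Casteljau step replaces differentiation. It is generalized over
  \<open>c\<close> because the hypothesis is applied to \<open>c\<close> and to its shift.\<close>

lemma sum_Bernstein_lipschitz:
  assumes "x \<in> {0..1}" "y \<in> {0..1}" "\<And>k. k < n \<Longrightarrow> \<bar>c (Suc k) - c k\<bar> \<le> D"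
  shows "\<bar>(\<Sum>k\<le>n. Bernstein n k x * c k) - (\<Sum>k\<le>n. Bernstein n k y * c k)\<bar>
           \<le> real n * D * \<bar>x - y\<bar>"
  using assms(3)
proof (induction n arbitrary: c)
  case 0
  then show ?case by (simp add: Bernstein_def)
next
  case (Suc n)
  define g where "g a z = (\<Sum>k\<le>n. Bernstein n k z * a k)" for a z
  define c' where "c' = (\<lambda>k. c (Suc k))"
  let ?L = "real n * D * \<bar>x - y\<bar>"
  have 1: "\<bar>g c x - g c y\<bar> \<le> ?L" and 2: "\<bar>g c' x - g c' y\<bar> \<le> ?L"
    unfolding g_def c'_def by (rule Suc.IH; use Suc.prems in simp)+
  have "g c' y - g c y = (\<Sum>k\<le>n. Bernstein n k y * (c (Suc k) - c k))"
    by (simp add: g_def c'_def sum_subtractf right_diff_distrib)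
  then have 3: "\<bar>g c' y - g c y\<bar> \<le> D"
    using abs_sum_Bernstein_le[OF assms(2), of n "\<lambda>k. c (Suc k) - c k" D] Suc.prems by simp
  \<comment> \<open>The increment is split so that the first two terms are a convex combination of
    bounds from the induction hypothesis; moving the blend weight from \<open>y\<close> to
    \<open>x\<close> costs one further \<open>D * \<bar>x - y\<bar>\<close>.\<close>
  have "\<bar>(1 - x) * (g c x - g c y) + x * (g c' x - g c' y) + (x - y) * (g c' y - g c y)\<bar>
      \<le> (1 - x) * ?L + x * ?L + \<bar>x - y\<bar> * D"
    using 1 2 3 assms(1)
    by (intro order_trans[OF abs_triangle_ineq] add_mono) (auto simp: abs_mult intro!: mult_mono)
  moreover have "(1 - x) * (g c x - g c y) + x * (g c' x - g c' y) + (x - y) * (g c' y - g c y) =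
      ((1 - x) * g c x + x * g c' x) - ((1 - y) * g c y + y * g c' y)"
    by (simp add: algebra_simps)
  ultimately show ?case
    unfolding sum_Bernstein_Suc by (simp add: g_def c'_def algebra_simps)
qed

section \<open>Translations and norms\<close>

lemma distr_lebesgue_translation: "distr lebesgue lebesgue ((+) (t::real)) = lebesgue"
  using lebesgue_real_affine[of 1 t] by (simp add: density_1 flip: one_ennreal_def)

lemma measurable_lebesgue_translation [measurable]: "(+) (t::real) \<in> lebesgue \<rightarrow>\<^sub>M lebesgue"
  using lebesgue_affine_measurable[of "\<lambda>_. 1" t] by simp

lemma AE_lebesgue_translation:
  assumes "AE x in lebesgue. P x"
  shows "AE x in lebesgue. P (t + x :: real)"
  by (rule AE_distrD[OF measurable_lebesgue_translation[of t], where P = P,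
        unfolded distr_lebesgue_translation, OF assms])

lemma integrable_lebesgue_translation:
  "integrable lebesgue f \<Longrightarrow> integrable lebesgue (\<lambda>x. f (t + x :: real) :: real)"
  using integrable_distr[OF measurable_lebesgue_translation, of t f]
  by (simp add: distr_lebesgue_translation)

lemma integral_lebesgue_translation:
  fixes f :: "real \<Rightarrow> real"
  assumes "f \<in> borel_measurable lebesgue"
  shows "(\<integral>x. f (t + x) \<partial>lebesgue) = (\<integral>x. f x \<partial>lebesgue)"
  using integral_distr[OF measurable_lebesgue_translation assms, of t]
  by (simp add: distr_lebesgue_translation)

lemma AE_Lp_norm_infinity: "AE x in lebesgue_on {0..1}. ennreal \<bar>g x\<bar> \<le> Lp_norm \<infinity> g"
  unfolding Lp_norm_def by (simp add: esssup_AE)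

text \<open>The interval has measure 1, so integrating the pointwise bound \<open>C powr q\<close>
  and taking the root returns \<open>C\<close>.\<close>

lemma Lp_norm_le:
  assumes g: "g \<in> borel_measurable (lebesgue_on {0..1})" and p: "1 \<le> p"
    and le: "AE x in lebesgue_on {0..1}. \<bar>g x\<bar> \<le> C" and C: "0 \<le> C"
  shows "Lp_norm p g \<le> ennreal C"
proof (cases "p = \<infinity>")
  case True
  then show ?thesis
    using g le unfolding Lp_norm_def by (auto intro!: esssup_I simp: C elim: AE_mp)
next
  case False
  define q where "q = enn2real p"
  have "0 < q"
    using p False unfolding q_def enn2real_positive_iff
    by (metis infinity_ennreal_def less_top less_le_trans zero_less_one)
  define I where "I = (\<integral>\<^sup>+ x. ennreal (\<bar>g x\<bar> powr q) \<partial>lebesgue_on {0..1})"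
  have "I \<le> (\<integral>\<^sup>+ x. ennreal (C powr q) \<partial>lebesgue_on {0..1::real})"
    unfolding I_def
  proof (rule nn_integral_mono_AE)
    show "AE x in lebesgue_on {0..1}. ennreal (\<bar>g x\<bar> powr q) \<le> ennreal (C powr q)"
      using le by eventually_elim (use \<open>0 < q\<close> in \<open>auto intro!: powr_mono2 ennreal_leI\<close>)
  qed
  also have "\<dots> = ennreal (C powr q)"
    by (simp add: emeasure_restrict_space)
  finally have I: "I \<le> ennreal (C powr q)" .
  then have "enn2real I \<le> C powr q"
    by (simp add: enn2real_leI)
  then have "enn2real I powr (1 / q) \<le> (C powr q) powr (1 / q)"
    using \<open>0 < q\<close> by (intro powr_mono2) auto
  also have "\<dots> = C"
    using \<open>0 < q\<close> C by (simp add: powr_powr)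
  \<comment> \<open>The bound on \<open>I\<close> makes it finite, so the definition takes its
    finite branch.\<close>
  finally show ?thesis
    using I False unfolding Lp_norm_def I_def[symmetric] q_def[symmetric]
    by (auto simp: Let_def top_unique intro!: ennreal_leI)
qed

section \<open>Oscillation of a function close to its Kantorovich polynomial\<close>

text \<open>The factor \<open>n + 1\<close> is the reciprocal of the cell length. These means are
  the Bernstein coefficients of the Kantorovich polynomial.\<close>

definition cell_mean :: "nat \<Rightarrow> (real \<Rightarrow> real) \<Rightarrow> nat \<Rightarrow> real" where
  "cell_mean n f k =
     (real n + 1) * (LINT t:{real k / (real n + 1)..(real k + 1) / (real n + 1)}|lebesgue. f t)"

lemma kantorovich_eq: "kantorovich n f x = (\<Sum>k\<le>n. Bernstein n k x * cell_mean n f k)"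
  by (simp add: kantorovich_def cell_mean_def sum_distrib_left mult.left_commute)

text \<open>Replacing \<open>f\<close> by its polynomial costs \<open>e\<close> at each of the two
  points, and the polynomial is Lipschitz. The error bound at \<open>x + h\<close> holds for almost
  every \<open>x\<close> because translations preserve null sets.\<close>

lemma AE_shift_le:
  assumes e: "AE x in lebesgue. x \<in> {0..1} \<longrightarrow> \<bar>kantorovich n f x - f x\<bar> \<le> e"
    and D: "\<And>k. k < n \<Longrightarrow> \<bar>cell_mean n f (Suc k) - cell_mean n f k\<bar> \<le> D"
  shows "AE x in lebesgue. x \<in> {0..1} \<and> x + h \<in> {0..1} \<longrightarrow>
           \<bar>f (x + h) - f x\<bar> \<le> 2 * e + real n * D * \<bar>h\<bar>"
  using e AE_lebesgue_translation[OF e, of h]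
proof eventually_elim
  case (elim x)
  have "\<bar>kantorovich n f (x + h) - kantorovich n f x\<bar> \<le> real n * D * \<bar>h\<bar>"
    if "x \<in> {0..1}" "x + h \<in> {0..1}"
    using sum_Bernstein_lipschitz[where n = n and c = "cell_mean n f" and D = D, OF that(2,1) D] by (simp add: kantorovich_eq)
  then show ?case
    using elim by (auto simp: add.commute)
qed

text \<open>Translation by the cell length carries one cell onto the next, so the difference of the
  means is the mean of \<open>f (x + d) - f x\<close> over the first cell.\<close>

lemma cell_mean_diff_le:
  assumes f: "set_integrable lebesgue {0..1} f" and k: "k < n"
    and C: "AE x in lebesgue. x \<in> {0..1} \<and> x + 1 / (real n + 1) \<in> {0..1} \<longrightarrow>
           \<bar>f (x + 1 / (real n + 1)) - f x\<bar> \<le> C"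
  shows "\<bar>cell_mean n f (Suc k) - cell_mean n f k\<bar> \<le> C"
proof -
  define d where "d = 1 / (real n + 1)"
  have d: "0 < d" by (simp add: d_def)
  define J where "J = (\<lambda>k. {real k / (real n + 1)..(real k + 1) / (real n + 1)})"
  have sub: "J j \<subseteq> {0..1}" if "j \<le> n" for j
    using that by (auto simp: J_def field_simps intro: order_trans[rotated])
  have shift: "d + x \<in> J (Suc k) \<longleftrightarrow> x \<in> J k" for x
    by (auto simp: J_def d_def add_divide_distrib)
  have int: "set_integrable lebesgue (J j) f" if "j \<le> n" for j
    by (rule set_integrable_subset[OF f _ sub[OF that]]) (simp add: J_def)
  have eq: "(\<lambda>x. indicator (J (Suc k)) (d + x) *\<^sub>R f (d + x)) = (\<lambda>x. indicator (J k) x *\<^sub>R f (d + x))"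
    by (auto simp: indicator_def shift)
  have i1: "set_integrable lebesgue (J k) (\<lambda>x. f (d + x))"
    using integrable_lebesgue_translation[OF int[unfolded set_integrable_def], of "Suc k" d] k
    unfolding set_integrable_def eq by simp
  have "(LINT t:J (Suc k)|lebesgue. f t) = (LINT t:J k|lebesgue. f (d + t))"
    using integral_lebesgue_translation[of "\<lambda>x. indicator (J (Suc k)) x *\<^sub>R f x" d]
      int[of "Suc k"] k
    unfolding set_lebesgue_integral_def eq set_integrable_def by (simp add: borel_measurable_integrable)
  then have diff: "(LINT t:J (Suc k)|lebesgue. f t) - (LINT t:J k|lebesgue. f t)
      = (LINT t:J k|lebesgue. f (d + t) - f t)"
    using i1 int[of k] k by simp
  have JC: "set_integrable lebesgue (J k) (\<lambda>x. C)" "(LINT t:J k|lebesgue. C) = C * d"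
    by (simp_all add: J_def d_def set_integrable_def set_lebesgue_integral_def field_simps)
  have "\<bar>LINT t:J k|lebesgue. f (d + t) - f t\<bar> \<le> (LINT t:J k|lebesgue. C)"
    unfolding set_lebesgue_integral_def
  proof (rule integral_abs_bound[THEN order_trans], rule integral_mono_AE)
    show "AE x in lebesgue. \<bar>indicat_real (J k) x *\<^sub>R (f (d + x) - f x)\<bar> \<le> indicat_real (J k) x *\<^sub>R C"
      using C
    proof eventually_elim
      case (elim x)
      \<comment> \<open>Since \<open>k < n\<close>, the translated cell also lies in
        \<open>{0..1}\<close>, where the bound \<open>C\<close> is available.\<close>
      have "x \<in> J k \<Longrightarrow> x \<in> {0..1} \<and> x + d \<in> {0..1}"
        using sub[of k] sub[of "Suc k"] shift[of x] k by (auto simp: add.commute)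
      with elim show ?case
        by (auto simp: indicator_def d_def add.commute)
    qed
  qed (use JC(1) i1 int[of k] k in \<open>auto simp: set_integrable_def right_diff_distrib\<close>)
  then have le: "\<bar>(LINT t:J (Suc k)|lebesgue. f t) - (LINT t:J k|lebesgue. f t)\<bar> \<le> C * d"
    by (simp only: JC(2) diff)
  have "cell_mean n f (Suc k) - cell_mean n f k =
      ((LINT t:J (Suc k)|lebesgue. f t) - (LINT t:J k|lebesgue. f t)) / d"
    by (simp only: cell_mean_def J_def d_def) (simp add: algebra_simps)
  then show ?thesis
    using le d by (simp add: pos_divide_le_eq)
qed

text \<open>A self-improving estimate: the largest difference reappears on the right with factor
  \<open>n / (n + 1) < 1\<close> and can be absorbed, being a maximum of finitely many
  reals.\<close>

lemma cell_mean_diff_le_error: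
  assumes f: "set_integrable lebesgue {0..1} f" and k: "k < n"
    and e: "AE x in lebesgue. x \<in> {0..1} \<longrightarrow> \<bar>kantorovich n f x - f x\<bar> \<le> e"
  shows "\<bar>cell_mean n f (Suc k) - cell_mean n f k\<bar> \<le> 2 * (real n + 1) * e"
proof -
  define S where "S = (\<lambda>k. \<bar>cell_mean n f (Suc k) - cell_mean n f k\<bar>) ` {..<n}"
  have S: "finite S" "S \<noteq> {}"
    using k by (auto simp: S_def)
  have le: "\<bar>cell_mean n f (Suc j) - cell_mean n f j\<bar> \<le> Max S" if "j < n" for j
    using that S by (auto simp: S_def intro!: Max_ge)
  have "\<bar>cell_mean n f (Suc j) - cell_mean n f j\<bar> \<le> 2 * e + real n * Max S * (1 / (real n + 1))"
    if "j < n" for j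
    using cell_mean_diff_le[OF f that AE_shift_le[OF e le]] by simp
  then have "Max S \<le> 2 * e + real n * Max S * (1 / (real n + 1))"
    using S by (subst Max_le_iff) (auto simp: S_def)
  then have "Max S \<le> 2 * (real n + 1) * e"
    by (simp add: field_simps)
  then show ?thesis
    using le[OF k] by simp
qed

text \<open>As \<open>n^3 + n^2 = n * (n * (n + 1))\<close>, the admissible shifts reduce the
  Lipschitz term to at most \<open>2 * e / n\<close>.\<close>

lemma AE_small_shift_le:
  assumes f: "set_integrable lebesgue {0..1} f" and n: "1 \<le> n"
    and e: "AE x in lebesgue. x \<in> {0..1} \<longrightarrow> \<bar>kantorovich n f x - f x\<bar> \<le> e" "0 \<le> e"
    and h: "\<bar>h\<bar> \<le> 1 / (real n ^ 3 + real n ^ 2)"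
  shows "AE x in lebesgue. x \<in> {0..1} \<and> x + h \<in> {0..1} \<longrightarrow> \<bar>f (x + h) - f x\<bar> \<le> 4 * e"
proof -
  let ?D = "2 * (real n + 1) * e"
  have "real n * ?D * \<bar>h\<bar> \<le> real n * ?D * (1 / (real n ^ 3 + real n ^ 2))"
    using h e(2) by (intro mult_left_mono) auto
  also have "\<dots> = 2 * e / real n"
  proof -
    have "real n * (real n + 1) \<noteq> 0"
      using n by (simp add: add_eq_0_iff)
    moreover have "real n * ?D * (1 / (real n ^ 3 + real n ^ 2)) =
        (2 * e * (real n * (real n + 1))) / (real n * (real n * (real n + 1)))"
      by (simp add: power3_eq_cube power2_eq_square algebra_simps add_divide_distrib)
    ultimately show ?thesis
      by (metis nonzero_mult_divide_mult_cancel_right)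
  qed
  also have "\<dots> \<le> 2 * e"
    using n e(2) by (simp add: divide_le_eq mult_le_cancel_left1)
  finally have "2 * e + real n * ?D * \<bar>h\<bar> \<le> 4 * e" by simp
  with AE_shift_le[OF e(1) cell_mean_diff_le_error[OF f _ e(1)], of h] show ?thesis
    by (auto elim!: AE_mp)
qed

theorem corollary4:
  fixes p :: ennreal
  assumes "1 \<le> p"
  shows "\<exists>N::nat. \<forall>n\<ge>N. \<forall>f::real \<Rightarrow> real. integrable (lebesgue_on {0..1}) f \<longrightarrow>
           ennreal (1 / 6) * modulus1 p f (1 / (real n ^ 3 + real n ^ 2))
             \<le> Lp_norm \<infinity> (\<lambda>x. kantorovich n f x - f x)"
proof (intro exI[of _ 1] allI impI)
  fix n :: nat and f :: "real \<Rightarrow> real"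
  assume n: "1 \<le> n" and int: "integrable (lebesgue_on {0..1}) f"
  let ?E = "Lp_norm \<infinity> (\<lambda>x. kantorovich n f x - f x)"
  let ?t = "1 / (real n ^ 3 + real n ^ 2)"
  have f: "set_integrable lebesgue {0..1} f"
    using int by (simp add: set_integrable_def integrable_restrict_space)
  show "ennreal (1 / 6) * modulus1 p f ?t \<le> ?E"
  \<comment> \<open>An infinite right-hand side is trivial; otherwise the error norm is a real
    \<open>e >= 0\<close>.\<close>
  proof (cases ?E)
    case top
    then show ?thesis by simp
  next
    case (real e)
    have e: "AE x in lebesgue. x \<in> {0..1} \<longrightarrow> \<bar>kantorovich n f x - f x\<bar> \<le> e"
      using AE_Lp_norm_infinity[of "\<lambda>x. kantorovich n f x - f x"] real
      by (simp add: AE_restrict_space_iff)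
    \<comment> \<open>Nothing is known about \<open>f\<close> outside \<open>{0..1}\<close>. Its
      extension by zero is measurable on the whole line, hence so are its translates, and it agrees
      with \<open>f\<close> wherever the cutoff is nonzero.\<close>
    define F where "F = (\<lambda>x. indicat_real {0..1} x * f x)"
    have F: "F \<in> borel_measurable lebesgue"
      using f by (auto simp: set_integrable_def F_def dest: borel_measurable_integrable)
    have "Lp_norm p (\<lambda>x. indicat_real {x \<in> {0..1}. x + h \<in> {0..1}} x * (f (x + h) - f x)) \<le> ennreal (4 * e)"
      if h: "\<bar>h\<bar> \<le> ?t" for h
    proof (rule Lp_norm_le[OF _ assms])
      have 1: "(\<lambda>x. F (h + x)) \<in> borel_measurable lebesgue"
        by (rule measurable_compose[OF measurable_lebesgue_translation F])
      have 2: "(\<lambda>x. indicat_real {0..1} (h + x)) \<in> borel_measurable lebesgue"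
        by (rule measurable_compose[OF measurable_lebesgue_translation borel_measurable_indicator]) simp
      have "(\<lambda>x. indicat_real {x \<in> {0..1}. x + h \<in> {0..1}} x * (f (x + h) - f x)) =
          (\<lambda>x. indicat_real {0..1} x * indicat_real {0..1} (h + x) * (F (h + x) - F x))"
        by (auto simp: F_def indicator_def add.commute)
      also have "\<dots> \<in> borel_measurable lebesgue"
        by (intro borel_measurable_times borel_measurable_diff 1 2 F borel_measurable_indicator) simp
      finally show "(\<lambda>x. indicat_real {x \<in> {0..1}. x + h \<in> {0..1}} x * (f (x + h) - f x))
          \<in> borel_measurable (lebesgue_on {0..1})"
        by (rule measurable_restrict_space1)
      show "AE x in lebesgue_on {0..1}.
          \<bar>indicat_real {x \<in> {0..1}. x + h \<in> {0..1}} x * (f (x + h) - f x)\<bar> \<le> 4 * e"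
        using AE_small_shift_le[OF f n e \<open>0 \<le> e\<close> h] \<open>0 \<le> e\<close>
        by (auto simp: AE_restrict_space_iff indicator_def elim!: AE_mp)
    qed (use \<open>0 \<le> e\<close> in simp)
    then have "modulus1 p f ?t \<le> ennreal (4 * e)"
      unfolding modulus1_def by (intro SUP_least) auto
    then have "ennreal (1 / 6) * modulus1 p f ?t \<le> ennreal (1 / 6) * ennreal (4 * e)"
      by (rule mult_left_mono) simp
    also have "\<dots> = ennreal (4 * e / 6)"
      using \<open>0 \<le> e\<close> by (simp flip: ennreal_mult)
    \<comment> \<open>The constants combine to \<open>4/6\<close>, which is below 1.\<close>
    also have "\<dots> \<le> ?E"
      using real \<open>0 \<le> e\<close> by (auto intro!: ennreal_leI)
    finally show ?thesis .
  qed
qed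

end
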